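(* Let $G$ be a Dehn-Sommerville $q$-variety with vertex set $V(G)$, let $k\ge 1$, $A_k=\{0,1,\dots,k\}$, and let $g:V(G)\to A_k$ be an arbitrary function. Extend $g$ to $G$ by $g(x)=\{g(v): v\in x\}$ and put $G_g=\{x\in G: g(x)=A_k\}$. If $G_g$ is non-empty, then $G_g$ is a Dehn-Sommerville $(q-k)$-variety.
   Context: A finite abstract simplicial complex $G$ is a finite set of non-empty finite sets closed under taking non-empty subsets; its vertices are its one-element sets. The star of $x\in G$ is $U(x)=\{y\in G: x\subset y\}$, $\overline{U(x)}=\{z\in G: z\subset y\text{ for some }y\in U(x)\}$, and the unit sphere is $S(x)=\overline{U(x)}\setminus U(x)$. The empty complex is the Dehn-Sommerville $(-1)$-variety; inductively, for $q\ge0$, a non-empty complex is a Dehn-Sommerville $q$-variety if every unit sphere $S(x)$ is a Dehn-Sommerville $(q-1)$-variety. Graph version: for a finite simple graph, the unit sphere of a vertex is the subgraph induced by its neighbours; the empty graph is the Dehn-Sommerville $(-1)$-variety graph and, for $q\ge 0$, a non-empty graph is a Dehn-Sommerville $q$-variety graph if every unit sphere is a Dehn-Sommerville $(q-1)$-variety graph. A subset $U\subset G$ is called a Dehn-Sommerville $m$-variety if the graph with vertex set $U$ and edges $\{x,y\}$ for distinct $x,y\in U$ with $x\subset y$ or $y\subset x$ is a Dehn-Sommerville $m$-variety graph. *)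

theory Defs
  imports "HOL-Library.FuncSet"
begin

definition simplicial_complex :: "'a set set \<Rightarrow> bool" where
  "simplicial_complex G \<longleftrightarrow>
     finite G \<and> (\<forall>x\<in>G. finite x \<and> x \<noteq> {}) \<and> (\<forall>x\<in>G. \<forall>y. y \<subseteq> x \<and> y \<noteq> {} \<longrightarrow> y \<in> G)"

text \<open>A vertex, i.e. a one-element set \<open>{v}\<close> of the complex, is identified with the point \<open>v\<close>.\<close>

definition complex_vertices :: "'a set set \<Rightarrow> 'a set" where
  "complex_vertices G = {v. {v} \<in> G}"

definition star :: "'a set set \<Rightarrow> 'a set \<Rightarrow> 'a set set" where
  "star G x = {y \<in> G. x \<subseteq> y}"

definition star_closure :: "'a set set \<Rightarrow> 'a set \<Rightarrow> 'a set set" where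
  "star_closure G x = {z \<in> G. \<exists>y \<in> star G x. z \<subseteq> y}"

definition unit_sphere :: "'a set set \<Rightarrow> 'a set \<Rightarrow> 'a set set" where
  "unit_sphere G x = star_closure G x - star G x"

inductive DS_complex :: "int \<Rightarrow> 'a set set \<Rightarrow> bool" where
  empty: "DS_complex (-1) {}"
| step: "\<lbrakk>q \<ge> 0; simplicial_complex G; G \<noteq> {}; \<forall>x\<in>G. DS_complex (q - 1) (unit_sphere G x)\<rbrakk>
           \<Longrightarrow> DS_complex q G"

text \<open>A simple graph is a pair of a vertex set and a set of two-element sets of vertices.\<close>

type_synonym 'v graph = "'v set \<times> 'v set set"

definition finite_simple_graph :: "'v graph \<Rightarrow> bool" where
  "finite_simple_graph \<Gamma> \<longleftrightarrow>
     finite (fst \<Gamma>) \<and> (\<forall>e \<in> snd \<Gamma>. e \<subseteq> fst \<Gamma> \<and> card e = 2)"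

definition induced_subgraph :: "'v graph \<Rightarrow> 'v set \<Rightarrow> 'v graph" where
  "induced_subgraph \<Gamma> W = (fst \<Gamma> \<inter> W, {e \<in> snd \<Gamma>. e \<subseteq> W})"

definition neighbours :: "'v graph \<Rightarrow> 'v \<Rightarrow> 'v set" where
  "neighbours \<Gamma> v = {w \<in> fst \<Gamma>. {v, w} \<in> snd \<Gamma>}"

definition graph_unit_sphere :: "'v graph \<Rightarrow> 'v \<Rightarrow> 'v graph" where
  "graph_unit_sphere \<Gamma> v = induced_subgraph \<Gamma> (neighbours \<Gamma> v)"

inductive DS_graph :: "int \<Rightarrow> 'v graph \<Rightarrow> bool" where
  empty: "DS_graph (-1) ({}, {})"
| step: "\<lbrakk>q \<ge> 0; finite_simple_graph \<Gamma>; fst \<Gamma> \<noteq> {};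
          \<forall>v \<in> fst \<Gamma>. DS_graph (q - 1) (graph_unit_sphere \<Gamma> v)\<rbrakk>
           \<Longrightarrow> DS_graph q \<Gamma>"

definition inclusion_graph :: "'a set set \<Rightarrow> 'a set graph" where
  "inclusion_graph U =
     (U, {{x, y} | x y. x \<in> U \<and> y \<in> U \<and> x \<noteq> y \<and> (x \<subseteq> y \<or> y \<subseteq> x)})"

definition DS_subset :: "int \<Rightarrow> 'a set set \<Rightarrow> bool" where
  "DS_subset m U \<longleftrightarrow> DS_graph m (inclusion_graph U)"

definition level_set :: "'a set set \<Rightarrow> ('a \<Rightarrow> nat) \<Rightarrow> nat \<Rightarrow> 'a set set" where
  "level_set G g k = {x \<in> G. g ` x = {0..k}}"

end

theory Submission
  imports Defs
begin

text \<open>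
  In a Dehn-Sommerville \<open>q\<close>-variety every simplex lies in one with \<open>q + 1\<close> vertices. Conversely, a
  finite graph is a Dehn-Sommerville \<open>m\<close>-variety graph as soon as all its maximal cliques have
  \<open>m + 1\<close> vertices, since the maximal cliques of the unit sphere of \<open>v\<close> become maximal cliques of the
  graph when \<open>v\<close> is adjoined. The maximal cliques to be counted are the maximal chains of \<open>G\<^sub>g\<close>.
  Along such a chain the cardinality takes each value from \<open>k + 1\<close> (one vertex of each colour) to
  \<open>q + 1\<close> exactly once, because \<open>G\<^sub>g\<close> contains every set lying between two of its members, so that
  a chain skipping a value could be refined. This gives \<open>q - k + 1\<close> elements.
\<close>

section \<open>Facets of Dehn-Sommerville complexes\<close>

lemma simplicial_complex_face:
  "simplicial_complex G \<Longrightarrow> x \<in> G \<Longrightarrow> y \<subseteq> x \<Longrightarrow> y \<noteq> {} \<Longrightarrow> y \<in> G"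
  unfolding simplicial_complex_def by metis

lemma simplicial_complex_finite: "simplicial_complex G \<Longrightarrow> finite G"
  by (simp add: simplicial_complex_def)

lemma simplicial_complex_finite_simplex: "simplicial_complex G \<Longrightarrow> x \<in> G \<Longrightarrow> finite x"
  by (simp add: simplicial_complex_def)

lemma DS_complex_simplicial_complex:
  assumes "DS_complex q G"
  shows "simplicial_complex G"
  using assms
proof cases
  case empty
  then show ?thesis
    by (simp add: simplicial_complex_def)
qed

lemma DS_complex_dimension_ge:
  assumes "DS_complex q G"
  shows "- 1 \<le> q"
  using assms by cases simp_all

text \<open>Admitting the empty face here and in the next lemma makes vertices no special case.\<close>

lemma insert_empty_unit_sphere_vertex:
  assumes "simplicial_complex G" "{v} \<in> G"
  shows "insert {} (unit_sphere G {v}) = {w. v \<notin> w \<and> insert v w \<in> G}"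
proof (intro set_eqI iffI)
  fix w assume "w \<in> insert {} (unit_sphere G {v})"
  then consider (empty) "w = {}" | (face) y where "y \<in> G" "v \<in> y" "w \<subseteq> y" "v \<notin> w"
    by (auto simp: unit_sphere_def star_closure_def star_def)
  then show "w \<in> {w. v \<notin> w \<and> insert v w \<in> G}"
  proof cases
    case empty
    then show ?thesis
      using assms(2) by simp
  next
    case face
    then show ?thesis
      using simplicial_complex_face[OF assms(1), of y "insert v w"] by simp
  qed
next
  fix w assume "w \<in> {w. v \<notin> w \<and> insert v w \<in> G}"
  then show "w \<in> insert {} (unit_sphere G {v})"
    using simplicial_complex_face[OF assms(1), of "insert v w" w]
    by (auto simp: unit_sphere_def star_closure_def star_def)
qed

lemma DS_complex_facet_or_empty:
  assumes "DS_complex q G" "z \<in> insert {} G"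
  shows "\<exists>y\<in>insert {} G. z \<subseteq> y \<and> int (card y) = q + 1"
  using assms
proof (induction arbitrary: z rule: DS_complex.induct)
  case empty
  then show ?case by simp
next
  case (step q G)
  note complex = \<open>simplicial_complex G\<close>
  obtain x where x: "x \<in> G" "z \<subseteq> x"
    using step.prems \<open>G \<noteq> {}\<close> by auto
  then have "x \<noteq> {}"
    using complex by (simp add: simplicial_complex_def)
  then obtain v where v: "v \<in> x"
    by blast
  have vertex: "{v} \<in> G"
    using simplicial_complex_face[OF complex x(1)] v by simp
  note link = insert_empty_unit_sphere_vertex[OF complex vertex]
  note link_facet = bspec[OF step.IH vertex, THEN conjunct2, rule_format, unfolded link]
  have "x - {v} \<in> {w. v \<notin> w \<and> insert v w \<in> G}"
    using x(1) v by (simp add: insert_absorb)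
  from link_facet[OF this] obtain y where cone: "v \<notin> y" "insert v y \<in> G"
      and y: "x - {v} \<subseteq> y" "int (card y) = q"
    by auto
  have "finite y"
    using simplicial_complex_finite_simplex[OF complex cone(2)] by simp
  then have "int (card (insert v y)) = q + 1"
    using cone(1) y(2) by simp
  moreover have "z \<subseteq> insert v y"
    using x(2) y(1) by blast
  ultimately show ?case
    using cone(2) by blast
qed

lemma DS_complex_facet:
  assumes "DS_complex q G" "z \<in> G"
  obtains y where "y \<in> G" "z \<subseteq> y" "int (card y) = q + 1"
proof -
  have "z \<noteq> {}"
    using DS_complex_simplicial_complex[OF assms(1)] assms(2) by (auto simp: simplicial_complex_def)
  then show ?thesis
    using DS_complex_facet_or_empty[OF assms(1), of z] assms(2) that by auto
qed

section \<open>Maximal cliques\<close>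

definition clique :: "'v graph \<Rightarrow> 'v set \<Rightarrow> bool" where
  "clique \<Gamma> C \<longleftrightarrow> C \<subseteq> fst \<Gamma> \<and> (\<forall>v\<in>C. \<forall>w\<in>C. v \<noteq> w \<longrightarrow> {v, w} \<in> snd \<Gamma>)"

definition maximal_clique :: "'v graph \<Rightarrow> 'v set \<Rightarrow> bool" where
  "maximal_clique \<Gamma> C \<longleftrightarrow> clique \<Gamma> C \<and> (\<nexists>D. clique \<Gamma> D \<and> C \<subset> D)"

lemma maximal_clique_extension:
  assumes "finite (fst \<Gamma>)" "clique \<Gamma> C"
  obtains M where "maximal_clique \<Gamma> M" "C \<subseteq> M"
proof -
  have "finite {D. clique \<Gamma> D}"
    using assms(1) by (rule finite_Pow_iff[THEN iffD2, THEN rev_finite_subset])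
      (auto simp: clique_def)
  then obtain M where "clique \<Gamma> M" "C \<subseteq> M" "\<forall>D. clique \<Gamma> D \<longrightarrow> M \<subseteq> D \<longrightarrow> M = D"
    using finite_has_maximal2[of "{D. clique \<Gamma> D}" C] assms(2) by auto
  then have "maximal_clique \<Gamma> M"
    by (auto simp: maximal_clique_def)
  with that \<open>C \<subseteq> M\<close> show ?thesis by blast
qed

lemma finite_clique: "finite (fst \<Gamma>) \<Longrightarrow> clique \<Gamma> C \<Longrightarrow> finite C"
  by (auto simp: clique_def intro: finite_subset)

lemma maximal_clique_empty_iff: "maximal_clique \<Gamma> {} \<longleftrightarrow> fst \<Gamma> = {}"
proof
  assume maximal: "maximal_clique \<Gamma> {}"
  show "fst \<Gamma> = {}"
  proof (rule equals0I)
    fix v assume "v \<in> fst \<Gamma>"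
    then have "clique \<Gamma> {v}"
      by (simp add: clique_def)
    with maximal show False
      by (auto simp: maximal_clique_def)
  qed
qed (auto simp: maximal_clique_def clique_def)

lemma finite_simple_graph_unit_sphere:
  "finite_simple_graph \<Gamma> \<Longrightarrow> finite_simple_graph (graph_unit_sphere \<Gamma> v)"
  by (auto simp: finite_simple_graph_def graph_unit_sphere_def induced_subgraph_def)

lemma clique_graph_unit_sphere_iff:
  assumes "finite_simple_graph \<Gamma>" "v \<in> fst \<Gamma>"
  shows "clique (graph_unit_sphere \<Gamma> v) C \<longleftrightarrow> v \<notin> C \<and> clique \<Gamma> (insert v C)"
proof -
  have "{v, v} \<notin> snd \<Gamma>"
    using assms(1) by (auto simp: finite_simple_graph_def)
  then have "v \<notin> neighbours \<Gamma> v"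
    by (simp add: neighbours_def)
  have "clique (graph_unit_sphere \<Gamma> v) C \<longleftrightarrow> C \<subseteq> neighbours \<Gamma> v \<and> clique \<Gamma> C"
    unfolding clique_def graph_unit_sphere_def induced_subgraph_def neighbours_def by auto
  also have "\<dots> \<longleftrightarrow> v \<notin> C \<and> (\<forall>w\<in>C. {v, w} \<in> snd \<Gamma>) \<and> clique \<Gamma> C"
    using \<open>v \<notin> neighbours \<Gamma> v\<close> unfolding clique_def neighbours_def by blast
  also have "\<dots> \<longleftrightarrow> v \<notin> C \<and> clique \<Gamma> (insert v C)"
    using assms(2) unfolding clique_def by (auto simp: insert_commute[of _ v])
  finally show ?thesis .
qed

lemma maximal_clique_insert_centre:
  assumes "finite_simple_graph \<Gamma>" "v \<in> fst \<Gamma>" "maximal_clique (graph_unit_sphere \<Gamma> v) C"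
  shows "v \<notin> C" "maximal_clique \<Gamma> (insert v C)"
proof -
  note sphere = clique_graph_unit_sphere_iff[OF assms(1,2)]
  show "v \<notin> C"
    using assms(3) by (simp add: maximal_clique_def sphere)
  have False if "clique \<Gamma> D" "insert v C \<subset> D" for D
  proof -
    have "insert v D = D"
      using that(2) by blast
    then have "clique (graph_unit_sphere \<Gamma> v) (D - {v})"
      using that(1) by (simp add: sphere)
    moreover have "C \<subset> D - {v}"
      using that(2) \<open>v \<notin> C\<close> by blast
    ultimately show False
      using assms(3) by (auto simp: maximal_clique_def)
  qed
  then show "maximal_clique \<Gamma> (insert v C)"
    using assms(3) by (auto simp: maximal_clique_def sphere)
qed

lemma DS_graph_if_card_maximal_cliques:
  assumes "finite_simple_graph \<Gamma>" "\<And>C. maximal_clique \<Gamma> C \<Longrightarrow> card C = n"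
  shows "DS_graph (int n - 1) \<Gamma>"
  using assms
proof (induction n arbitrary: \<Gamma>)
  case 0
  have finite_vertices: "finite (fst \<Gamma>)"
    using "0.prems"(1) by (simp add: finite_simple_graph_def)
  obtain M where M: "maximal_clique \<Gamma> M"
    using maximal_clique_extension[OF finite_vertices, of "{}"] by (auto simp: clique_def)
  then have "M = {}"
    using "0.prems"(2)[OF M] finite_clique[OF finite_vertices] by (auto simp: maximal_clique_def)
  then have "fst \<Gamma> = {}"
    using M by (simp add: maximal_clique_empty_iff)
  moreover from this have "snd \<Gamma> = {}"
    using "0.prems"(1) by (fastforce simp: finite_simple_graph_def)
  ultimately have "\<Gamma> = ({}, {})"
    by (simp add: prod_eq_iff)
  then show ?case
    by (simp add: DS_graph.empty)
next
  case (Suc n)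
  have nonempty: "fst \<Gamma> \<noteq> {}"
    using Suc.prems(2)[of "{}"] by (auto simp: maximal_clique_empty_iff)
  have spheres: "\<forall>v\<in>fst \<Gamma>. DS_graph (int n - 1) (graph_unit_sphere \<Gamma> v)"
  proof (intro ballI Suc.IH)
    fix v assume v: "v \<in> fst \<Gamma>"
    show "finite_simple_graph (graph_unit_sphere \<Gamma> v)"
      using Suc.prems(1) by (rule finite_simple_graph_unit_sphere)
    fix C assume "maximal_clique (graph_unit_sphere \<Gamma> v) C"
    note cone = maximal_clique_insert_centre[OF Suc.prems(1) v this]
    have "card (insert v C) = Suc n"
      using cone(2) by (rule Suc.prems(2))
    then show "card C = n"
      using cone(1) card.infinite[of "insert v C"] by (cases "finite C") auto
  qed
  have "DS_graph (int n) \<Gamma>"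
    using of_nat_0_le_iff Suc.prems(1) nonempty spheres by (rule DS_graph.step)
  then show ?case
    by simp
qed

lemma finite_simple_inclusion_graph:
  assumes "finite U"
  shows "finite_simple_graph (inclusion_graph U)"
proof -
  have "e \<subseteq> U \<and> card e = 2" if edge: "e \<in> snd (inclusion_graph U)" for e
  proof -
    obtain x y where "e = {x, y}" "x \<in> U" "y \<in> U" "x \<noteq> y"
      using edge unfolding inclusion_graph_def snd_conv by blast
    then show ?thesis
      by simp
  qed
  then show ?thesis
    using assms by (simp add: finite_simple_graph_def inclusion_graph_def)
qed

lemma clique_inclusion_graph_iff: "clique (inclusion_graph U) C \<longleftrightarrow> subset.chain U C"
proof -
  have "{x, y} \<in> snd (inclusion_graph U) \<longleftrightarrow> x \<in> U \<and> y \<in> U \<and> x \<noteq> y \<and> (x \<subseteq> y \<or> y \<subseteq> x)" for x y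
    unfolding inclusion_graph_def snd_conv mem_Collect_eq doubleton_eq_iff by blast
  moreover have "fst (inclusion_graph U) = U"
    by (simp add: inclusion_graph_def)
  ultimately show ?thesis
    unfolding clique_def subset_chain_def by (metis order_refl subsetD)
qed

lemma DS_subset_if_card_maxchains:
  assumes "finite U" "\<And>C. subset.maxchain U C \<Longrightarrow> card C = n"
  shows "DS_subset (int n - 1) U"
  unfolding DS_subset_def
proof (rule DS_graph_if_card_maximal_cliques)
  show "finite_simple_graph (inclusion_graph U)"
    using assms(1) by (rule finite_simple_inclusion_graph)
  show "card C = n" if "maximal_clique (inclusion_graph U) C" for C
    using that assms(2)
    by (simp add: maximal_clique_def clique_inclusion_graph_iff subset.maxchain_def)
qed

section \<open>Maximal chains in graded families of sets\<close>

lemma subset_maxchain_memI: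
  assumes "subset.maxchain U C" "y \<in> U" "\<And>x. x \<in> C \<Longrightarrow> x \<subseteq> y \<or> y \<subseteq> x"
  shows "y \<in> C"
proof -
  have "subset.chain U (insert y C)"
    using assms by (auto simp: subset.maxchain_def subset_chain_def)
  then show ?thesis
    using assms(1) by (auto simp: subset.maxchain_def)
qed

lemma subset_chain_card_le_iff:
  assumes "subset.chain U C" "x \<in> C" "y \<in> C" "finite x" "finite y"
  shows "card x \<le> card y \<longleftrightarrow> x \<subseteq> y"
  using assms by (metis card_mono card_seteq order_refl subset_chain_def)

locale graded_family =
  fixes U :: "'a set set" and a b :: nat
  assumes finite_family: "finite U"
    and finite_member: "x \<in> U \<Longrightarrow> finite x"
    and nonempty: "U \<noteq> {}"
    and between_mem: "x \<in> U \<Longrightarrow> z \<in> U \<Longrightarrow> x \<subseteq> y \<Longrightarrow> y \<subseteq> z \<Longrightarrow> y \<in> U"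
    and ex_lower: "x \<in> U \<Longrightarrow> \<exists>y\<in>U. y \<subseteq> x \<and> card y = a"
    and ex_upper: "x \<in> U \<Longrightarrow> \<exists>y\<in>U. x \<subseteq> y \<and> card y = b"
begin

lemma card_mem_interval: "x \<in> U \<Longrightarrow> card x \<in> {a..b}"
  using ex_lower[of x] ex_upper[of x] finite_member by (auto intro: card_mono)

lemma lower_le_upper: "a \<le> b"
  using nonempty card_mem_interval by fastforce

context
  fixes C :: "'a set set"
  assumes maxchain: "subset.maxchain U C"
begin

lemma maxchain_imp_chain: "subset.chain U C"
  using maxchain by (rule subset.maxchain_imp_chain)

lemma maxchain_subset: "C \<subseteq> U"
  using maxchain_imp_chain by (simp add: subset_chain_def)

lemma finite_maxchain: "finite C"
  using maxchain_subset finite_family by (rule finite_subset)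

lemma maxchain_subchain: "D \<subseteq> C \<Longrightarrow> subset.chain U D"
  using maxchain_imp_chain unfolding subset_chain_def by blast

lemma maxchain_nonempty: "C \<noteq> {}"
  using nonempty subset_maxchain_memI[OF maxchain] by blast

lemma Inter_subchain_mem: "D \<subseteq> C \<Longrightarrow> D \<noteq> {} \<Longrightarrow> \<Inter>D \<in> D"
  using finite_maxchain maxchain_subchain by (blast intro: Inter_in_chain finite_subset)

lemma Union_subchain_mem: "D \<subseteq> C \<Longrightarrow> D \<noteq> {} \<Longrightarrow> \<Union>D \<in> D"
  using finite_maxchain maxchain_subchain by (blast intro: Union_in_chain finite_subset)

lemma maxchain_card_le_iff: "x \<in> C \<Longrightarrow> y \<in> C \<Longrightarrow> card x \<le> card y \<longleftrightarrow> x \<subseteq> y"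
  using maxchain_subset finite_member by (intro subset_chain_card_le_iff[OF maxchain_imp_chain]) auto

lemma card_Inter_maxchain: "card (\<Inter>C) = a"
proof -
  have "\<Inter>C \<in> U"
    using Inter_subchain_mem[OF order_refl maxchain_nonempty] maxchain_subset by blast
  then obtain y where y: "y \<in> U" "y \<subseteq> \<Inter>C" "card y = a"
    using ex_lower by blast
  have "y \<in> C"
    using y(2) by (intro subset_maxchain_memI[OF maxchain y(1)]) blast
  then have "y = \<Inter>C"
    using y(2) by blast
  then show ?thesis
    using y(3) by simp
qed

lemma card_Union_maxchain: "card (\<Union>C) = b"
proof -
  have "\<Union>C \<in> U"
    using Union_subchain_mem[OF order_refl maxchain_nonempty] maxchain_subset by blast
  then obtain y where y: "y \<in> U" "\<Union>C \<subseteq> y" "card y = b"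
    using ex_upper by blast
  have "y \<in> C"
    using y(2) by (intro subset_maxchain_memI[OF maxchain y(1)]) blast
  then have "y = \<Union>C"
    using y(2) by blast
  then show ?thesis
    using y(3) by simp
qed

lemma maxchain_ex_card_eq:
  assumes "j \<in> {a..b}"
  shows "\<exists>y\<in>C. card y = j"
proof -
  define below above where "below = {x \<in> C. card x \<le> j}" and "above = {x \<in> C. j \<le> card x}"
  have sub: "below \<subseteq> C" "above \<subseteq> C"
    by (auto simp: below_def above_def)
  have "\<Inter>C \<in> below" "\<Union>C \<in> above"
    using assms card_Inter_maxchain card_Union_maxchain maxchain_nonempty
    by (simp_all add: below_def above_def Inter_subchain_mem Union_subchain_mem)
  then have "\<Union>below \<in> below" "\<Inter>above \<in> above"
    using Union_subchain_mem[OF sub(1)] Inter_subchain_mem[OF sub(2)] by blast+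
  then have card: "card (\<Union>below) \<le> j" "j \<le> card (\<Inter>above)"
      and gap: "\<Union>below \<in> C" "\<Inter>above \<in> C"
    by (simp_all add: below_def above_def)
  have "\<Union>below \<subseteq> \<Inter>above"
    using card maxchain_card_le_iff[OF gap] by simp
  moreover have "finite (\<Inter>above)"
    using gap(2) maxchain_subset finite_member by blast
  ultimately obtain y where y: "\<Union>below \<subseteq> y" "y \<subseteq> \<Inter>above" "card y = j"
    using exists_subset_between[OF card] by blast
  have "y \<in> U"
    using gap maxchain_subset y(1,2) by (blast intro: between_mem)
  moreover have "x \<subseteq> y \<or> y \<subseteq> x" if "x \<in> C" for x
  proof -
    have "x \<in> below \<or> x \<in> above"
      using that by (auto simp: below_def above_def)
    then show ?thesis
      using y(1,2) by blast
  qed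
  ultimately have "y \<in> C"
    by (rule subset_maxchain_memI[OF maxchain])
  then show ?thesis
    using y(3) by blast
qed

lemma card_maxchain: "card C = Suc b - a"
proof -
  have "inj_on card C"
    by (intro inj_onI subset_antisym) (simp_all flip: maxchain_card_le_iff)
  moreover have "card ` C = {a..b}"
    using maxchain_subset card_mem_interval maxchain_ex_card_eq by blast
  ultimately show ?thesis
    by (metis card_image card_atLeastAtMost)
qed

end

lemma DS_subset: "DS_subset (int b - int a) U"
proof -
  have "DS_subset (int (Suc b - a) - 1) U"
    using finite_family card_maxchain by (rule DS_subset_if_card_maxchains)
  then show ?thesis
    using lower_le_upper by simp
qed

end

section \<open>Level sets\<close>

lemma level_set_superset:
  assumes "simplicial_complex G" "g \<in> complex_vertices G \<rightarrow> {0..k}"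
    and "x \<in> level_set G g k" "y \<in> G" "x \<subseteq> y"
  shows "y \<in> level_set G g k"
proof -
  have "{v} \<in> G" if "v \<in> y" for v
    using simplicial_complex_face[OF assms(1,4)] that by simp
  then have "g ` y \<subseteq> {0..k}"
    using assms(2) by (auto simp: complex_vertices_def)
  moreover have "{0..k} \<subseteq> g ` y"
    using image_mono[OF assms(5), of g] assms(3) by (simp add: level_set_def)
  ultimately show ?thesis
    using assms(4) by (simp add: level_set_def)
qed

lemma level_set_transversal:
  assumes "simplicial_complex G" "x \<in> level_set G g k"
  shows "\<exists>y\<in>level_set G g k. y \<subseteq> x \<and> card y = Suc k"
proof -
  have x: "x \<in> G" "g ` x = {0..k}"
    using assms(2) by (simp_all add: level_set_def)
  obtain y where y: "y \<subseteq> x" "inj_on g y" "g ` y = {0..k}"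
    using subset_image_inj[of "{0..k}" g x] x(2) by auto
  then have "y \<noteq> {}"
    by auto
  then have "y \<in> G"
    by (rule simplicial_complex_face[OF assms(1) x(1) y(1)])
  moreover have "card y = Suc k"
    using card_image[OF y(2)] y(3) by simp
  ultimately show ?thesis
    using y by (auto simp: level_set_def)
qed

lemma level_set_graded_family:
  assumes "DS_complex q G" "g \<in> complex_vertices G \<rightarrow> {0..k}" "level_set G g k \<noteq> {}"
    and "int b = q + 1"
  shows "graded_family (level_set G g k) (Suc k) b"
proof
  note complex = DS_complex_simplicial_complex[OF assms(1)]
  note superset = level_set_superset[OF complex assms(2)]
  have level_subset: "level_set G g k \<subseteq> G"
    by (auto simp: level_set_def)
  show "finite (level_set G g k)"
    using level_subset simplicial_complex_finite[OF complex] by (rule finite_subset)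
  show "level_set G g k \<noteq> {}"
    by (fact assms(3))
  fix x assume x: "x \<in> level_set G g k"
  show "finite x"
    using complex x level_subset by (blast intro: simplicial_complex_finite_simplex)
  show "\<exists>y\<in>level_set G g k. y \<subseteq> x \<and> card y = Suc k"
    using complex x by (rule level_set_transversal)
  show "\<exists>y\<in>level_set G g k. x \<subseteq> y \<and> card y = b"
  proof -
    obtain y where "y \<in> G" "x \<subseteq> y" "int (card y) = q + 1"
      using DS_complex_facet[OF assms(1)] x level_subset by blast
    then show ?thesis
      using superset[OF x] assms(4) by auto
  qed
  show "y \<in> level_set G g k" if "z \<in> level_set G g k" "x \<subseteq> y" "y \<subseteq> z" for y z
  proof (rule superset[OF x])
    have "x \<noteq> {}"
      using x by (auto simp: level_set_def)
    then show "y \<in> G"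
      using simplicial_complex_face[OF complex, of z y] that level_subset by blast
  qed (fact \<open>x \<subseteq> y\<close>)
qed

theorem mainTheorem3:
  fixes G :: "'a set set" and g :: "'a \<Rightarrow> nat" and q :: int and k :: nat
  assumes "DS_complex q G"
    and "k \<ge> 1"
    and "g \<in> complex_vertices G \<rightarrow> {0..k}"
    and "level_set G g k \<noteq> {}"
  shows "DS_subset (q - int k) (level_set G g k)"
proof -
  have dim: "int (nat (q + 1)) = q + 1"
    using DS_complex_dimension_ge[OF assms(1)] by simp
  interpret graded_family "level_set G g k" "Suc k" "nat (q + 1)"
    using assms(1,3,4) dim by (rule level_set_graded_family)
  have "int (nat (q + 1)) - int (Suc k) = q - int k"
    using dim by simp
  then show ?thesis
    using DS_subset by metis
qed

end
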